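(* Every topological group having an $f_1^\star$-productive sequence contains a subspace homeomorphic to the Cantor set.
   Context: All topological groups are Hausdorff; $\mathbb N=\{0,1,2,\dots\}$. Products are ordered: $\prod_{n=0}^m b_n=b_0b_1\cdots b_m$. A sequence $\{b_n:n\in\mathbb N\}$ in a topological group $G$ is productive if $\{\prod_{n=0}^m b_n:m\in\mathbb N\}$ converges to some element of $G$. A sequence $\{a_n:n\in\mathbb N\}$ of elements of $G$ is $f_1^\star$-productive in $G$ if it is faithfully indexed ($a_n\ne a_m$ for $n\ne m$) and the sequence $\{a_n^{z(n)}:n\in\mathbb N\}$ is productive in $G$ for every function $z:\mathbb N\to\{0,1\}$. (Here $f_1$ is the constant function with value $1$.) *)

theory Defs
  imports "HOL-Analysis.Analysis" "HOL-Algebra.Group"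
begin

text \<open>
  Topological groups are Hausdorff by convention. The group is a (multiplicative, not
  necessarily commutative) HOL-Algebra group, and its topology is an abstract topology
  whose underlying set is the carrier.
\<close>

locale topological_group = group G for G (structure) +
  fixes T :: "'a topology"
  assumes topspace_eq_carrier: "topspace T = carrier G"
    and continuous_mult: "continuous_map (prod_topology T T) T (\<lambda>(x, y). x \<otimes> y)"
    and continuous_inv: "continuous_map T T (\<lambda>x. inv x)"
    and hausdorff: "Hausdorff_space T"

text \<open>The ordered product \<open>b 0 \<otimes> b 1 \<otimes> \<dots> \<otimes> b m\<close>, both end points included.\<close>

primrec ordered_prod :: "('a, 'b) monoid_scheme \<Rightarrow> (nat \<Rightarrow> 'a) \<Rightarrow> nat \<Rightarrow> 'a" where
  "ordered_prod G b 0 = b 0"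
| "ordered_prod G b (Suc m) = ordered_prod G b m \<otimes>\<^bsub>G\<^esub> b (Suc m)"

definition productive ::
    "('a, 'b) monoid_scheme \<Rightarrow> 'a topology \<Rightarrow> (nat \<Rightarrow> 'a) \<Rightarrow> bool" where
  "productive G T b \<longleftrightarrow>
     range b \<subseteq> carrier G \<and>
     (\<exists>g \<in> carrier G. limitin T (\<lambda>m. ordered_prod G b m) g sequentially)"

definition f1_star_productive ::
    "('a, 'b) monoid_scheme \<Rightarrow> 'a topology \<Rightarrow> (nat \<Rightarrow> 'a) \<Rightarrow> bool" where
  "f1_star_productive G T a \<longleftrightarrow>
     range a \<subseteq> carrier G \<and> inj a \<and>
     (\<forall>z :: nat \<Rightarrow> nat. range z \<subseteq> {0, 1} \<longrightarrow> productive G T (\<lambda>n. a n [^]\<^bsub>G\<^esub> z n))"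

text \<open>
  The middle-thirds Cantor set. Deleting the open middle third of every component of
  \<open>cantor_stage n\<close> yields two copies of \<open>cantor_stage n\<close> scaled by 1/3.
\<close>

primrec cantor_stage :: "nat \<Rightarrow> real set" where
  "cantor_stage 0 = {0..1}"
| "cantor_stage (Suc n) =
     (\<lambda>x. x / 3) ` cantor_stage n \<union> (\<lambda>x. (2 + x) / 3) ` cantor_stage n"

definition cantor_set :: "real set" where
  "cantor_set = (\<Inter>n. cantor_stage n)"

end

theory Submission
  imports Defs
begin

text \<open>
  For binary \<open>z\<close> let \<open>\<phi> z\<close> be the infinite product of the factors \<open>a n\<close> with \<open>z n\<close> true. Since
  every selection of factors converges, the tails of these products tend to \<open>\<one>\<close> uniformly
  in \<open>z\<close>, so \<open>\<phi>\<close> is continuous on the compact space of binary sequences. Passing to a subsequence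
  \<open>a (r i)\<close> along which the tails past \<open>r (Suc i)\<close> lie too close to \<open>\<one>\<close> for \<open>a (r i)\<close> to be
  a quotient of two of them makes \<open>\<phi>\<close> injective, hence an embedding.
\<close>

section \<open>The space of binary sequences\<close>

abbreviation bin_seq_top :: "(nat \<Rightarrow> bool) topology" where
  "bin_seq_top \<equiv> product_topology (\<lambda>_. discrete_topology UNIV) UNIV"

lemma compact_space_bin_seq: "compact_space bin_seq_top"
  by (simp add: compact_space_product_topology compact_space_discrete_topology)

lemma openin_cylinder: "openin bin_seq_top {w. \<forall>k<n. w k = z k}"
proof -
  have eq: "{w. \<forall>k<n. w k = z k} = PiE UNIV (\<lambda>k. if k < n then {z k} else UNIV)"
    by (auto simp: PiE_def Pi_def split: if_splits)
  have "finite {i \<in> UNIV. (if i < n then {z i} else UNIV) \<noteq> topspace (discrete_topology (UNIV::bool set))}"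
    by (rule finite_subset[of _ "{..<n}"]) auto
  then show ?thesis
    unfolding eq openin_PiE_gen by auto
qed

text \<open>The sets of sequences sharing an initial segment with \<open>z\<close> form a
  neighbourhood base at \<open>z\<close>. Continuity thus becomes dependence, up to a given open
  set, on finitely many leading bits.\<close>

lemma continuous_map_bin_seqI:
  assumes "\<And>z. f z \<in> topspace Y"
    and "\<And>z U. openin Y U \<Longrightarrow> f z \<in> U \<Longrightarrow> \<exists>n. \<forall>w. (\<forall>k<n. w k = z k) \<longrightarrow> f w \<in> U"
  shows "continuous_map bin_seq_top Y f"
  unfolding continuous_map_def
proof (intro conjI allI impI)
  fix U assume U: "openin Y U"
  have "\<exists>V. openin bin_seq_top V \<and> z \<in> V \<and> V \<subseteq> {x \<in> topspace bin_seq_top. f x \<in> U}"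
    if fz: "f z \<in> U" for z
  proof -
    obtain n where "\<forall>w. (\<forall>k<n. w k = z k) \<longrightarrow> f w \<in> U"
      using assms(2)[OF U fz] by blast
    then show ?thesis
      by (intro exI[of _ "{w. \<forall>k<n. w k = z k}"]) (auto simp: openin_cylinder)
  qed
  then show "openin bin_seq_top {x \<in> topspace bin_seq_top. f x \<in> U}"
    by (subst openin_subopen) auto
qed (use assms(1) in auto)

text \<open>A continuous map from a compact space to a Hausdorff space is closed, and a closed
  continuous injection is an embedding. This serves both for the Cantor set and for the image inside
  the group.\<close>

lemma bin_seq_homeomorphic_image:
  assumes "Hausdorff_space Y" "continuous_map bin_seq_top Y f" "inj f"
  shows "bin_seq_top homeomorphic_space subtopology Y (range f)"
proof -
  have "closed_map bin_seq_top Y f"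
    using assms compact_space_bin_seq by (simp add: continuous_imp_closed_map_gen Hausdorff_imp_kc_space)
  then have "embedding_map bin_seq_top Y f"
    using assms by (intro injective_closed_imp_embedding_map) auto
  then show ?thesis
    using embedding_map_imp_homeomorphic_space by fastforce
qed

section \<open>The Cantor set\<close>

text \<open>The standard coding of the Cantor set: bits become the ternary digits 0 and 2.\<close>

definition ternary :: "(nat \<Rightarrow> bool) \<Rightarrow> real" where
  "ternary z = (\<Sum>n. 2 * of_bool (z n) / 3 ^ Suc n)"

lemma geometric_thirds_sums: "(\<lambda>n. 2 / 3 ^ Suc n) sums (1::real)"
proof -
  have "(\<lambda>n. (2/3) * (1/3::real) ^ n) sums ((2/3) * (1 / (1 - 1/3)))"
    by (intro sums_mult geometric_sums) auto
  then show ?thesis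
    by (simp add: power_one_over)
qed

lemma summable_ternary: "summable (\<lambda>n. 2 * of_bool (z n) / 3 ^ Suc n :: real)"
proof (rule summable_comparison_test')
  show "summable (\<lambda>n. 2 / 3 ^ Suc n :: real)"
    using geometric_thirds_sums by (rule sums_summable)
qed auto

lemma ternary_bounds: "0 \<le> ternary z" "ternary z \<le> 1"
proof -
  show "0 \<le> ternary z"
    unfolding ternary_def by (intro suminf_nonneg summable_ternary) auto
  have "ternary z \<le> (\<Sum>n. 2 / 3 ^ Suc n)"
    unfolding ternary_def
    using geometric_thirds_sums summable_ternary
    by (intro suminf_le) (auto simp: sums_iff)
  then show "ternary z \<le> 1"
    using geometric_thirds_sums by (simp add: sums_iff)
qed

text \<open>Splitting off the leading digit turns the series into the two affine maps in the
  recursion of \<open>cantor_stage\<close>; the inductions on digits below all rest on it.\<close>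

lemma ternary_shift: "ternary z = (2 * of_bool (z 0) + ternary (\<lambda>n. z (Suc n))) / 3"
proof -
  have "ternary z = 2 * of_bool (z 0) / 3 + (\<Sum>n. 2 * of_bool (z (Suc n)) / 3 ^ Suc (Suc n))"
    unfolding ternary_def using suminf_split_head[OF summable_ternary[of z]] by simp
  also have "(\<Sum>n. 2 * of_bool (z (Suc n)) / 3 ^ Suc (Suc n)) = ternary (\<lambda>n. z (Suc n)) / 3"
    unfolding ternary_def using suminf_divide[OF summable_ternary[of "\<lambda>n. z (Suc n)"], of 3]
    by (simp add: mult_ac)
  finally show ?thesis
    by (simp add: add_divide_distrib)
qed

lemma ternary_close:
  "(\<forall>k<n. w k = z k) \<Longrightarrow> \<bar>ternary w - ternary z\<bar> \<le> 1 / 3 ^ n"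
proof (induction n arbitrary: w z)
  case 0
  show ?case using ternary_bounds[of w] ternary_bounds[of z] by auto
next
  case (Suc n)
  have "\<bar>ternary (\<lambda>n. w (Suc n)) - ternary (\<lambda>n. z (Suc n))\<bar> \<le> 1 / 3 ^ n"
    using Suc.prems by (intro Suc.IH) auto
  moreover have "w 0 = z 0" using Suc.prems by auto
  ultimately show ?case
    by (subst (1 2) ternary_shift) (simp add: field_simps abs_if split: if_splits)
qed

text \<open>The leading digit contributes 0 or 2/3, the remaining ones at most 1/3, so a different
  leading digit could not be compensated.\<close>

lemma ternary_eq_first:
  assumes "ternary w = ternary z"
  shows "w 0 = z 0" "ternary (\<lambda>n. w (Suc n)) = ternary (\<lambda>n. z (Suc n))"
  using assms ternary_shift[of w] ternary_shift[of z] ternary_bounds[of "\<lambda>n. w (Suc n)"]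
    ternary_bounds[of "\<lambda>n. z (Suc n)"]
  by (auto simp: of_bool_def split: if_splits)

lemma inj_ternary: "inj ternary"
proof (rule injI)
  fix w z assume eq: "ternary w = ternary z"
  have "ternary w = ternary z \<Longrightarrow> w n = z n" for n
  proof (induction n arbitrary: w z)
    case 0
    then show ?case by (rule ternary_eq_first)
  next
    case (Suc n)
    show ?case by (rule Suc.IH[OF ternary_eq_first(2)[OF Suc.prems]])
  qed
  with eq show "w = z" by blast
qed

lemma continuous_ternary: "continuous_map bin_seq_top euclideanreal ternary"
proof (rule continuous_map_bin_seqI)
  fix z and U :: "real set" assume "openin euclideanreal U" "ternary z \<in> U"
  then obtain e where e: "e > 0" "\<And>x. \<bar>x - ternary z\<bar> < e \<Longrightarrow> x \<in> U"
    by (metis open_openin open_dist dist_real_def)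
  obtain n where "(1/3::real) ^ n < e"
    using real_arch_pow_inv[of e "1/3"] e(1) by auto
  then have "1 / 3 ^ n < e" by (simp add: power_one_over)
  then show "\<exists>n. \<forall>w. (\<forall>k<n. w k = z k) \<longrightarrow> ternary w \<in> U"
    using e(2) ternary_close order_le_less_trans by blast
qed auto

lemma cantor_stage_subset: "cantor_stage n \<subseteq> {0..1}"
  by (induction n) force+

lemma ternary_in_cantor_stage: "ternary z \<in> cantor_stage n"
proof (induction n arbitrary: z)
  case 0
  show ?case using ternary_bounds by simp
next
  case (Suc n)
  show ?case
    using Suc[of "\<lambda>n. z (Suc n)"] by (subst ternary_shift) (auto simp: of_bool_def)
qed

text \<open>Every \<open>cantor_stage (Suc n)\<close> misses the gap between 1/3 and 2/3. Comparing
  \<open>x\<close> with 1/2 therefore picks the same branch at all stages, and one \<open>y\<close>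
  works for every \<open>n\<close>.\<close>

lemma cantor_set_cases:
  assumes "x \<in> cantor_set"
  obtains b y where "y \<in> cantor_set" "x = (2 * of_bool b + y) / 3"
proof (cases "x \<le> 1/2")
  case True
  have "3 * x \<in> cantor_stage n" for n
  proof -
    have "x \<in> cantor_stage (Suc n)" using assms unfolding cantor_set_def by blast
    then show ?thesis using True cantor_stage_subset[of n] by force
  qed
  then show ?thesis
    by (intro that[of "3 * x" False]) (auto simp: cantor_set_def)
next
  case False
  have "3 * x - 2 \<in> cantor_stage n" for n
  proof -
    have "x \<in> cantor_stage (Suc n)" using assms unfolding cantor_set_def by blast
    then obtain y where "y \<in> cantor_stage n" "x = y / 3 \<or> x = (2 + y) / 3" by auto
    moreover from this have "y \<in> {0..1}" using cantor_stage_subset by blast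
    ultimately have "3 * x - 2 = y" using False by auto
    with \<open>y \<in> cantor_stage n\<close> show ?thesis by simp
  qed
  then show ?thesis
    by (intro that[of "3 * x - 2" True]) (auto simp: cantor_set_def)
qed

lemma range_ternary: "range ternary = cantor_set"
proof
  show "range ternary \<subseteq> cantor_set"
    using ternary_in_cantor_stage by (auto simp: cantor_set_def)
  show "cantor_set \<subseteq> range ternary"
  proof
    fix x assume x: "x \<in> cantor_set"
    have "\<exists>b y. y \<in> cantor_set \<and> u = (2 * of_bool b + y) / 3" if "u \<in> cantor_set" for u
      using that cantor_set_cases by metis
    \<comment> \<open>\<open>d\<close> reads off the leading digit and \<open>r\<close> is the
      rescaled remainder; iterating \<open>r\<close> produces the whole expansion.\<close>
    then obtain d r where dr: "\<And>u. u \<in> cantor_set \<Longrightarrow> r u \<in> cantor_set"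
      "\<And>u. u \<in> cantor_set \<Longrightarrow> u = (2 * of_bool (d u) + r u) / 3"
      by metis
    \<comment> \<open>The claim covers every point of \<open>cantor_set\<close> because the
      induction passes from \<open>u\<close> to \<open>r u\<close>; each step gains a factor
      1/3.\<close>
    have "\<bar>u - ternary (\<lambda>k. d ((r ^^ k) u))\<bar> \<le> 1 / 3 ^ n" if "u \<in> cantor_set" for u n
      using that
    proof (induction n arbitrary: u)
      case 0
      have "u \<in> {0..1}" using 0 by (auto simp: cantor_set_def dest: spec[of _ 0])
      then show ?case using ternary_bounds[of "\<lambda>k. d ((r ^^ k) u)"] by auto
    next
      case (Suc n)
      have IH: "\<bar>r u - ternary (\<lambda>k. d ((r ^^ k) (r u)))\<bar> \<le> 1 / 3 ^ n"
        by (rule Suc.IH) (rule dr(1)[OF Suc.prems])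
      have "ternary (\<lambda>k. d ((r ^^ k) u))
          = (2 * of_bool (d u) + ternary (\<lambda>k. d ((r ^^ k) (r u)))) / 3"
        by (subst ternary_shift) (simp add: funpow_swap1)
      then have "u - ternary (\<lambda>k. d ((r ^^ k) u))
          = (r u - ternary (\<lambda>k. d ((r ^^ k) (r u)))) / 3"
        using dr(2)[OF Suc.prems] by (metis add_diff_cancel_left diff_divide_distrib)
      with IH show ?case by simp
    qed
    then have *: "\<bar>x - ternary (\<lambda>k. d ((r ^^ k) x))\<bar> \<le> (1/3) ^ n" for n
      using x by (simp add: power_one_over)
    have "\<bar>x - ternary (\<lambda>k. d ((r ^^ k) x))\<bar> \<le> 0"
      by (rule LIMSEQ_le_const[OF LIMSEQ_realpow_zero[of "1/3"]]) (use * in auto)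
    then show "x \<in> range ternary" by auto
  qed
qed

lemma bin_seq_homeomorphic_cantor_set:
  "bin_seq_top homeomorphic_space top_of_set cantor_set"
  using bin_seq_homeomorphic_image[OF _ continuous_ternary inj_ternary] range_ternary
  by simp

section \<open>Infinite products in a topological group\<close>

text \<open>The factors have indices in the half-open interval from \<open>p\<close> to
  \<open>p + l\<close>, and the empty product is allowed, so that adjacent blocks concatenate
  exactly. \<open>ordered_prod\<close> includes its last index, hence the shift by one between the
  two.\<close>

primrec seg_prod :: "('a, 'b) monoid_scheme \<Rightarrow> (nat \<Rightarrow> 'a) \<Rightarrow> nat \<Rightarrow> nat \<Rightarrow> 'a" where
  "seg_prod G b p 0 = \<one>\<^bsub>G\<^esub>"
| "seg_prod G b p (Suc l) = seg_prod G b p l \<otimes>\<^bsub>G\<^esub> b (p + l)"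

definition select :: "('a, 'b) monoid_scheme \<Rightarrow> (nat \<Rightarrow> 'a) \<Rightarrow> (nat \<Rightarrow> bool) \<Rightarrow> nat \<Rightarrow> 'a" where
  "select G a z n = (if z n then a n else \<one>\<^bsub>G\<^esub>)"

lemma seg_prod_cong:
  "(\<And>k. p \<le> k \<Longrightarrow> k < p + l \<Longrightarrow> b k = c k) \<Longrightarrow> seg_prod G b p l = seg_prod G c p l"
  by (induction l) auto

context topological_group
begin

lemma seg_prod_closed: "range b \<subseteq> carrier G \<Longrightarrow> seg_prod G b p l \<in> carrier G"
  by (induction l) auto

lemma seg_prod_add:
  assumes "range b \<subseteq> carrier G"
  shows "seg_prod G b p (k + l) = seg_prod G b p k \<otimes> seg_prod G b (p + k) l"
  using seg_prod_closed[OF assms] assms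
  by (induction l) (auto simp: m_assoc add.assoc image_subset_iff)

lemma seg_prod_trivial:
  "(\<And>k. p \<le> k \<Longrightarrow> k < p + l \<Longrightarrow> b k = \<one>) \<Longrightarrow> seg_prod G b p l = \<one>"
  by (induction l) auto

lemma ordered_prod_eq_seg_prod:
  "range b \<subseteq> carrier G \<Longrightarrow> ordered_prod G b m = seg_prod G b 0 (Suc m)"
  by (induction m) (auto simp: image_subset_iff)

lemma range_select: "range a \<subseteq> carrier G \<Longrightarrow> range (select G a z) \<subseteq> carrier G"
  by (auto simp: select_def)

lemma openin_mult_nbhds:
  assumes "openin T U" "x \<in> carrier G" "y \<in> carrier G" "x \<otimes> y \<in> U"
  obtains A B where "openin T A" "openin T B" "x \<in> A" "y \<in> B"
    "\<And>u v. u \<in> A \<Longrightarrow> v \<in> B \<Longrightarrow> u \<otimes> v \<in> U"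
proof -
  have "openin (prod_topology T T) {p \<in> topspace (prod_topology T T). (\<lambda>(x, y). x \<otimes> y) p \<in> U}"
    using continuous_mult assms(1) by (rule openin_continuous_map_preimage)
  then have "\<exists>A B. openin T A \<and> openin T B \<and> x \<in> A \<and> y \<in> B \<and>
      A \<times> B \<subseteq> {p \<in> topspace (prod_topology T T). (\<lambda>(x, y). x \<otimes> y) p \<in> U}"
    unfolding openin_prod_topology_alt using assms topspace_eq_carrier by auto
  then show ?thesis
    using that by fastforce
qed

lemma openin_inv_image:
  assumes "openin T U"
  shows "openin T {x \<in> carrier G. inv x \<in> U}"
  using openin_continuous_map_preimage[OF continuous_inv assms] topspace_eq_carrier by simp

lemma openin_inv_mult_nbhds:
  assumes "openin T U" "x \<in> carrier G" "y \<in> carrier G" "inv x \<otimes> y \<in> U"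
  obtains A B where "openin T A" "openin T B" "x \<in> A" "y \<in> B"
    "\<And>u v. u \<in> A \<Longrightarrow> v \<in> B \<Longrightarrow> inv u \<otimes> v \<in> U"
proof -
  obtain A B where AB: "openin T A" "openin T B" "inv x \<in> A" "y \<in> B"
    "\<And>u v. u \<in> A \<Longrightarrow> v \<in> B \<Longrightarrow> u \<otimes> v \<in> U"
    using openin_mult_nbhds[of U "inv x" y] assms by auto
  show ?thesis
    by (rule that[OF openin_inv_image[OF AB(1)] AB(2)]) (use AB assms in auto)
qed

end

section \<open>Products over arbitrary selections from a sequence\<close>

locale selective_product = topological_group +
  fixes a :: "nat \<Rightarrow> 'a" and \<phi> :: "(nat \<Rightarrow> bool) \<Rightarrow> 'a"
  assumes range_a: "range a \<subseteq> carrier G"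
    and limit_\<phi>: "limitin T (\<lambda>m. seg_prod G (select G a z) 0 m) (\<phi> z) sequentially"
begin

abbreviation partial_prod :: "(nat \<Rightarrow> bool) \<Rightarrow> nat \<Rightarrow> 'a" where
  "partial_prod z m \<equiv> seg_prod G (select G a z) 0 m"

lemma a_closed [simp]: "a n \<in> carrier G"
  using range_a by auto

lemma seg_prod_select_closed [simp]: "seg_prod G (select G a z) p l \<in> carrier G"
  by (intro seg_prod_closed range_select range_a)

lemma \<phi>_closed [simp]: "\<phi> z \<in> carrier G"
  using limitin_topspace[OF limit_\<phi>] topspace_eq_carrier by simp

lemma seg_prod_eq_quotient:
  "seg_prod G (select G a z) p l = inv (partial_prod z p) \<otimes> partial_prod z (p + l)"
  using seg_prod_add[OF range_select[OF range_a], of z 0 p l]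
  by (simp add: m_assoc[symmetric])

text \<open>A block is a quotient of two partial products, both of which are eventually close to
  \<open>\<phi> z\<close>. Here \<open>N\<close> still depends on \<open>z\<close>.\<close>

lemma seg_prods_Cauchy:
  assumes U: "openin T U" "\<one> \<in> U"
  shows "\<exists>N. \<forall>p\<ge>N. \<forall>l. seg_prod G (select G a z) p l \<in> U"
proof -
  obtain A B where AB: "openin T A" "openin T B" "\<phi> z \<in> A" "\<phi> z \<in> B"
    "\<And>u v. u \<in> A \<Longrightarrow> v \<in> B \<Longrightarrow> inv u \<otimes> v \<in> U"
    using openin_inv_mult_nbhds[OF U(1), of "\<phi> z" "\<phi> z"] U(2) by auto
  obtain N where "\<And>n. n \<ge> N \<Longrightarrow> partial_prod z n \<in> A \<inter> B"
    using limit_\<phi>[of z] openin_Int[OF AB(1,2)] AB(3,4)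
    unfolding limitin_sequentially by (meson IntI)
  then have "seg_prod G (select G a z) p l \<in> U" if "p \<ge> N" for p l
    using AB(5) that by (subst seg_prod_eq_quotient) simp
  then show ?thesis by blast
qed

text \<open>If blocks of factors arbitrarily far out had products outside \<open>U\<close>, one could
  place infinitely many of them on disjoint intervals of indices; the selection made of all
  these blocks would violate the Cauchy condition.\<close>

lemma seg_prods_small:
  assumes U: "openin T U" "\<one> \<in> U"
  shows "\<exists>m. \<forall>p\<ge>m. \<forall>l z. seg_prod G (select G a z) p l \<in> U"
proof (rule ccontr)
  assume "\<not> ?thesis"
  then have "\<forall>m. \<exists>p l z. p \<ge> m \<and> seg_prod G (select G a z) p l \<notin> U"
    by blast
  then obtain P L Z where PLZ: "\<And>m. P m \<ge> m"
    "\<And>m. seg_prod G (select G a (Z m)) (P m) (L m) \<notin> U"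
    by metis
  \<comment> \<open>An empty block has product \<open>\<one>\<close>, which lies in
    \<open>U\<close>.\<close>
  have Lpos: "L m > 0" for m
    using PLZ(2)[of m] U(2) by (cases "L m") auto
  \<comment> \<open>The \<open>i\<close>-th bad block is sought from \<open>s i\<close> on; it
    starts at \<open>P (s i)\<close> and ends just before \<open>s (Suc i)\<close>.\<close>
  define s where "s = rec_nat 0 (\<lambda>_ m. P m + L m)"
  have s_Suc: "s (Suc i) = P (s i) + L (s i)" for i
    by (simp add: s_def)
  have "strict_mono s"
    unfolding strict_mono_Suc_iff s_Suc
  proof
    show "s i < P (s i) + L (s i)" for i
      using PLZ(1)[of "s i"] Lpos[of "s i"] by linarith
  qed
  \<comment> \<open>The selection copies \<open>Z (s i)\<close> on the \<open>i\<close>-th block and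
    is false between blocks. Since the blocks are disjoint, each keeps its bad product.\<close>
  define z where "z n \<longleftrightarrow> (\<exists>i. P (s i) \<le> n \<and> n < s (Suc i) \<and> Z (s i) n)" for n
  have z_block: "z n = Z (s i) n" if n: "P (s i) \<le> n" "n < s (Suc i)" for n i
  proof -
    have "j = i" if j: "P (s j) \<le> n" "n < s (Suc j)" for j
    proof (rule ccontr)
      assume "j \<noteq> i"
      then have "s (Suc j) \<le> s i \<or> s (Suc i) \<le> s j"
        using \<open>strict_mono s\<close> by (metis Suc_leI linorder_neqE_nat strict_mono_less_eq)
      then show False
        using n j PLZ(1)[of "s i"] PLZ(1)[of "s j"] by linarith
    qed
    then show ?thesis using n unfolding z_def by blast
  qed
  have "seg_prod G (select G a z) (P (s i)) (L (s i)) \<notin> U" for i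
  proof -
    have "seg_prod G (select G a z) (P (s i)) (L (s i))
        = seg_prod G (select G a (Z (s i))) (P (s i)) (L (s i))"
      by (intro seg_prod_cong) (simp add: select_def z_block s_Suc)
    then show ?thesis using PLZ(2) by simp
  qed
  moreover obtain N where "\<And>p l. p \<ge> N \<Longrightarrow> seg_prod G (select G a z) p l \<in> U"
    using seg_prods_Cauchy[OF U] by blast
  moreover have "P (s N) \<ge> N"
    using PLZ(1)[of "s N"] strict_mono_imp_increasing[OF \<open>strict_mono s\<close>, of N] by linarith
  ultimately show False by blast
qed

text \<open>The tail past \<open>p\<close> is the block from \<open>p\<close> to
  \<open>p + N\<close> times the tail past \<open>p + N\<close>. The block is small uniformly in
  \<open>z\<close>, and the second factor is small once \<open>N\<close> is large.\<close>

lemma tails_small: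
  assumes U: "openin T U" "\<one> \<in> U"
  shows "\<exists>m. \<forall>p\<ge>m. \<forall>z. inv (partial_prod z p) \<otimes> \<phi> z \<in> U"
proof -
  obtain V B where V: "openin T V" "\<one> \<in> V" and B: "openin T B" "\<one> \<in> B"
    and VB: "\<And>u v. u \<in> V \<Longrightarrow> v \<in> B \<Longrightarrow> u \<otimes> v \<in> U"
    using openin_mult_nbhds[OF U(1), of \<one> \<one>] U(2) by (metis one_closed l_one)
  obtain m where m: "\<And>p l z. p \<ge> m \<Longrightarrow> seg_prod G (select G a z) p l \<in> V"
    using seg_prods_small[OF V] by blast
  have "inv (partial_prod z p) \<otimes> \<phi> z \<in> U" if "p \<ge> m" for p z
  proof -
    obtain A A' where A: "openin T A" "\<phi> z \<in> A" "\<phi> z \<in> A'"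
      "\<And>u v. u \<in> A \<Longrightarrow> v \<in> A' \<Longrightarrow> inv u \<otimes> v \<in> B"
      using openin_inv_mult_nbhds[OF B(1), of "\<phi> z" "\<phi> z"] B(2) by (metis \<phi>_closed l_inv)
    \<comment> \<open>\<open>N\<close> may depend on \<open>z\<close>: the bound \<open>m\<close>
      controls blocks of every length, and \<open>N\<close> cancels from the product.\<close>
    obtain N where "\<And>n. n \<ge> N \<Longrightarrow> partial_prod z n \<in> A"
      using limit_\<phi>[of z] A(1,2) unfolding limitin_sequentially by blast
    then have "inv (partial_prod z (p + N)) \<otimes> \<phi> z \<in> B"
      using A(3,4) by simp
    then have "seg_prod G (select G a z) p N \<otimes> (inv (partial_prod z (p + N)) \<otimes> \<phi> z) \<in> U"
      using VB m[OF that] by blast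
    moreover have cancel: "partial_prod z (p + N) \<otimes> (inv (partial_prod z (p + N)) \<otimes> \<phi> z) = \<phi> z"
      by (simp add: m_assoc[symmetric])
    have "seg_prod G (select G a z) p N \<otimes> (inv (partial_prod z (p + N)) \<otimes> \<phi> z)
        = inv (partial_prod z p) \<otimes> \<phi> z"
      by (subst seg_prod_eq_quotient[of z p]) (simp add: m_assoc inv_solve_left' cancel)
    ultimately show ?thesis by simp
  qed
  then show ?thesis by blast
qed

text \<open>\<open>\<phi> w\<close> is a partial product times a tail. If \<open>w\<close> agrees
  with \<open>z\<close> far enough, the partial product is that of \<open>z\<close>, hence near
  \<open>\<phi> z\<close>, while the tail is near \<open>\<one>\<close> uniformly in
  \<open>w\<close>.\<close>

lemma continuous_\<phi>: "continuous_map bin_seq_top T \<phi>"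
proof (rule continuous_map_bin_seqI)
  fix z U assume U: "openin T U" "\<phi> z \<in> U"
  obtain A V where AV: "openin T A" "openin T V" "\<phi> z \<in> A" "\<one> \<in> V"
    "\<And>u v. u \<in> A \<Longrightarrow> v \<in> V \<Longrightarrow> u \<otimes> v \<in> U"
    using openin_mult_nbhds[OF U(1), of "\<phi> z" \<one>] U(2) by auto
  obtain N where N: "\<And>n. n \<ge> N \<Longrightarrow> partial_prod z n \<in> A"
    using limit_\<phi>[of z] AV(1,3) unfolding limitin_sequentially by blast
  obtain m where m: "\<And>p w. p \<ge> m \<Longrightarrow> inv (partial_prod w p) \<otimes> \<phi> w \<in> V"
    using tails_small[OF AV(2,4)] by blast
  have "\<phi> w \<in> U" if w: "\<forall>k<max N m. w k = z k" for w
  proof -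
    have "partial_prod w (max N m) = partial_prod z (max N m)"
      using w by (intro seg_prod_cong) (simp add: select_def)
    then have "partial_prod w (max N m) \<otimes> (inv (partial_prod w (max N m)) \<otimes> \<phi> w) \<in> U"
      using AV(5)[OF N m, of "max N m" "max N m" w] by simp
    then show ?thesis by (simp add: m_assoc[symmetric])
  qed
  then show "\<exists>n. \<forall>w. (\<forall>k<n. w k = z k) \<longrightarrow> \<phi> w \<in> U" by blast
qed (simp add: topspace_eq_carrier)

text \<open>Points are closed, so the complement of \<open>x\<close> is a neighbourhood of
  \<open>\<one>\<close>. It contains all quotients of elements of a smaller neighbourhood, which
  holds all late tails.\<close>

lemma tail_quotients_avoid:
  assumes x: "x \<in> carrier G" "x \<noteq> \<one>"
  shows "\<exists>m. \<forall>p\<ge>m. \<forall>w z. (inv (partial_prod w p) \<otimes> \<phi> w) \<otimes> inv (inv (partial_prod z p) \<otimes> \<phi> z) \<noteq> x"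
proof -
  have "openin T (carrier G - {x})"
    using Hausdorff_imp_t1_space[OF hausdorff] x topspace_eq_carrier
    by (metis openin_diff closedin_t1_singleton openin_topspace)
  moreover have "\<one> \<in> carrier G - {x}" using x by auto
  ultimately obtain A B where AB: "openin T A" "openin T B" "\<one> \<in> A" "\<one> \<in> B"
    "\<And>u v. u \<in> A \<Longrightarrow> v \<in> B \<Longrightarrow> u \<otimes> v \<in> carrier G - {x}"
    using openin_mult_nbhds[of "carrier G - {x}" \<one> \<one>] by auto
  have "openin T (A \<inter> {x \<in> carrier G. inv x \<in> B})" "\<one> \<in> A \<inter> {x \<in> carrier G. inv x \<in> B}"
    using AB openin_inv_image by auto
  from tails_small[OF this] show ?thesis
    using AB(5) by (metis (no_types, lifting) DiffD2 IntD1 IntD2 mem_Collect_eq singletonI)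
qed

text \<open>Once \<open>a k\<close> is not a quotient of two tails past \<open>m\<close>, two selections that vanish on
  \<open>{k<..<m}\<close> and first differ at \<open>k\<close> have different products.\<close>

lemma \<phi>_separates:
  assumes agree: "\<And>i. i < k \<Longrightarrow> w i = z i"
    and gap: "\<And>i. k < i \<Longrightarrow> i < p \<Longrightarrow> \<not> w i \<and> \<not> z i"
    and "k < p" "w k" "\<not> z k"
    and avoid: "(inv (partial_prod z p) \<otimes> \<phi> z) \<otimes> inv (inv (partial_prod w p) \<otimes> \<phi> w) \<noteq> a k"
  shows "\<phi> w \<noteq> \<phi> z"
proof
  assume eq: "\<phi> w = \<phi> z"
  have split: "partial_prod v p = partial_prod v k \<otimes> select G a v k"
    if "\<And>i. k < i \<Longrightarrow> i < p \<Longrightarrow> \<not> v i" for v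
  proof -
    have "seg_prod G (select G a v) (Suc k) (p - Suc k) = \<one>"
      using that by (intro seg_prod_trivial) (auto simp: select_def)
    then show ?thesis
      using seg_prod_add[OF range_select[OF range_a], of v 0 "Suc k" "p - Suc k"] \<open>k < p\<close>
      by (simp add: select_def)
  qed
  have P: "partial_prod w k = partial_prod z k"
    using agree by (intro seg_prod_cong) (simp add: select_def)
  have "partial_prod w p = partial_prod z k \<otimes> a k"
    using split[of w] gap \<open>w k\<close> P by (simp add: select_def)
  moreover have "partial_prod z p = partial_prod z k"
    using split[of z] gap \<open>\<not> z k\<close> by (simp add: select_def)
  \<comment> \<open>With \<open>\<phi> w = \<phi> z\<close> the limits cancel in the quotient of
    tails, leaving the inverse of \<open>partial_prod z k\<close> times
    \<open>partial_prod z k \<otimes> a k\<close>, which is the excluded value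
    \<open>a k\<close>.\<close>
  moreover have "\<phi> z \<otimes> (inv \<phi> z \<otimes> (partial_prod z k \<otimes> a k)) = partial_prod z k \<otimes> a k"
    by (simp add: m_assoc[symmetric])
  ultimately show False
    using avoid eq by (simp add: inv_mult_group m_assoc inv_solve_left' inv_solve_left)
qed

text \<open>\<open>\<phi>\<close> itself can identify selections, as binary expansions show for the
  numbers 1/2^n in the additive reals. Composing with \<open>e\<close> allows only sparse indices to
  be selected.\<close>

lemma exists_injective_restriction:
  assumes "inj a"
  shows "\<exists>e. continuous_map bin_seq_top T (\<phi> \<circ> e) \<and> inj (\<phi> \<circ> e)"
proof -
  \<comment> \<open>An injective sequence takes the value \<open>\<one>\<close> at most
    once.\<close>
  have "\<exists>N0. \<forall>n\<ge>N0. a n \<noteq> \<one>"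
    using assms by (metis injD not_less_eq_eq order_refl)
  then obtain N0 where N0: "\<And>n. n \<ge> N0 \<Longrightarrow> a n \<noteq> \<one>"
    by blast
  have "\<exists>m. n \<ge> N0 \<longrightarrow> (\<forall>p\<ge>m. \<forall>w z.
      (inv (partial_prod w p) \<otimes> \<phi> w) \<otimes> inv (inv (partial_prod z p) \<otimes> \<phi> z) \<noteq> a n)" for n
    using tail_quotients_avoid[OF a_closed N0] by blast
  then obtain M where M: "\<And>n p w z. n \<ge> N0 \<Longrightarrow> p \<ge> M n \<Longrightarrow>
      (inv (partial_prod w p) \<otimes> \<phi> w) \<otimes> inv (inv (partial_prod z p) \<otimes> \<phi> z) \<noteq> a n"
    by metis
  \<comment> \<open>The next index passes \<open>M (r i)\<close>, so no quotient of two tails from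
    \<open>r (Suc i)\<close> on equals \<open>a (r i)\<close>.\<close>
  define r where "r = rec_nat N0 (\<lambda>_ n. max (Suc n) (M n))"
  have r_0: "r 0 = N0" and r_Suc: "r (Suc i) = max (Suc (r i)) (M (r i))" for i
    by (simp_all add: r_def)
  have r: "strict_mono r"
    unfolding strict_mono_Suc_iff r_Suc by (simp add: less_max_iff_disj)
  have r_ge: "r i \<ge> N0" for i
    using r_0 strict_mono_less_eq[OF r, of 0 i] by simp
  \<comment> \<open>Bit \<open>i\<close> is placed at index \<open>r i\<close> and all other indices
    stay false, which provides the gaps required by \<open>\<phi>_separates\<close>.\<close>
  define e where "e w n \<longleftrightarrow> (\<exists>i. n = r i \<and> w i)" for w n
  have e_r: "e w (r i) = w i" for w i
    unfolding e_def using strict_mono_eq[OF r] by auto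
  have e_gap: "\<not> e w n" if "r i < n" "n < r (Suc i)" for w n i
    using that strict_mono_less[OF r] unfolding e_def by (metis not_less_eq)
  have "\<phi> (e w) \<noteq> \<phi> (e z)" if "\<And>j. j < i \<Longrightarrow> w j = z j" "w i" "\<not> z i" for w z i
  proof (rule \<phi>_separates)
    show "e w n = e z n" if "n < r i" for n
      using \<open>\<And>j. j < i \<Longrightarrow> w j = z j\<close> strict_mono_less[OF r] that unfolding e_def by metis
    show "r i < r (Suc i)" using strict_mono_less[OF r] by simp
    show "(inv (partial_prod (e z) (r (Suc i))) \<otimes> \<phi> (e z)) \<otimes>
        inv (inv (partial_prod (e w) (r (Suc i))) \<otimes> \<phi> (e w)) \<noteq> a (r i)"
      by (rule M) (simp_all add: r_ge r_Suc)
  qed (use that e_r e_gap in auto)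
  \<comment> \<open>The roles of \<open>w\<close> and \<open>z\<close> are symmetric, so it does not
    matter which of them is true at \<open>i\<close>.\<close>
  then have sep: "\<phi> (e w) \<noteq> \<phi> (e z)" if "\<And>j. j < i \<Longrightarrow> w j = z j" "w i \<noteq> z i" for w z i
    using that by metis
  have "inj (\<phi> \<circ> e)"
  proof (rule injI, rule ccontr)
    fix w z assume eq: "(\<phi> \<circ> e) w = (\<phi> \<circ> e) z" and "w \<noteq> z"
    then have "\<exists>i. w i \<noteq> z i" by auto
    then have "\<exists>i. w i \<noteq> z i \<and> (\<forall>j<i. w j = z j)"
      using exists_least_iff[of "\<lambda>i. w i \<noteq> z i"] by blast
    then show False using sep eq by (metis comp_apply)
  qed
  moreover have "continuous_map bin_seq_top bin_seq_top e"
    unfolding continuous_map_componentwise_UNIV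
  proof
    fix n
    \<comment> \<open>If \<open>n = r i\<close> then \<open>i\<close> is at most \<open>n\<close>,
      so bit \<open>n\<close> of \<open>e w\<close> is determined by the first \<open>Suc n\<close>
      bits of \<open>w\<close>.\<close>
    have e_eq: "e w n = e z n" if "\<forall>k<Suc n. w k = z k" for w z
      using that strict_mono_imp_increasing[OF r] unfolding e_def by (metis less_Suc_eq_le)
    show "continuous_map bin_seq_top (discrete_topology UNIV) (\<lambda>w. e w n)"
    proof (intro continuous_map_bin_seqI)
      show "\<exists>m. \<forall>w. (\<forall>k<m. w k = z k) \<longrightarrow> e w n \<in> U" if "e z n \<in> U" for z U
      proof (intro exI allI impI)
        show "e w n \<in> U" if "\<forall>k<Suc n. w k = z k" for w
          using \<open>e z n \<in> U\<close> by (subst e_eq[OF that])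
      qed
    qed simp
  qed
  ultimately show ?thesis
    using continuous_map_compose[OF _ continuous_\<phi>] by blast
qed

end

section \<open>From productive sequences to the Cantor subspace\<close>

lemma (in topological_group) f1_star_productive_selective:
  assumes "f1_star_productive G T a"
  obtains \<phi> where "selective_product G T a \<phi>"
proof -
  have a: "range a \<subseteq> carrier G"
    using assms by (simp add: f1_star_productive_def)
  have "\<exists>g. limitin T (\<lambda>m. seg_prod G (select G a z) 0 m) g sequentially" for z
  proof -
    have "productive G T (\<lambda>n. a n [^] (of_bool (z n) :: nat))"
      using assms unfolding f1_star_productive_def by (auto simp: image_subset_iff)
    moreover have "(\<lambda>n. a n [^] (of_bool (z n) :: nat)) = select G a z"
      using a by (auto simp: select_def fun_eq_iff image_subset_iff)
    ultimately obtain g where "limitin T (\<lambda>m. ordered_prod G (select G a z) m) g sequentially"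
      unfolding productive_def by auto
    \<comment> \<open>\<open>ordered_prod\<close> up to \<open>m\<close> has \<open>m + 1\<close>
      factors; dropping the first term of the sequence of partial products leaves its limit
      unchanged.\<close>
    then have "limitin T (\<lambda>m. seg_prod G (select G a z) 0 (m + 1)) g sequentially"
      using ordered_prod_eq_seg_prod[OF range_select[OF a]] by simp
    then show ?thesis
      by (intro exI) (rule limitin_sequentially_offset_rev)
  qed
  then obtain \<phi> where "\<And>z. limitin T (\<lambda>m. seg_prod G (select G a z) 0 m) (\<phi> z) sequentially"
    by metis
  with a show ?thesis
    by (intro that[of \<phi>]) (unfold_locales, auto)
qed

theorem corollary8p3:
  fixes G :: "('a, 'b) monoid_scheme" and T :: "'a topology"
  assumes "topological_group G T"
    and "\<exists>a. f1_star_productive G T a"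
  shows "\<exists>S \<subseteq> topspace T. subtopology T S homeomorphic_space top_of_set cantor_set"
proof -
  interpret topological_group G T by fact
  obtain a where a: "f1_star_productive G T a"
    using assms(2) by blast
  then obtain \<phi> where "selective_product G T a \<phi>"
    by (rule f1_star_productive_selective)
  then interpret selective_product G T a \<phi> .
  obtain e where e: "continuous_map bin_seq_top T (\<phi> \<circ> e)" "inj (\<phi> \<circ> e)"
    using exists_injective_restriction a unfolding f1_star_productive_def by blast
  have "subtopology T (range (\<phi> \<circ> e)) homeomorphic_space top_of_set cantor_set"
    using bin_seq_homeomorphic_image[OF hausdorff e] bin_seq_homeomorphic_cantor_set
      homeomorphic_space_sym homeomorphic_space_trans by blast
  moreover have "range (\<phi> \<circ> e) \<subseteq> topspace T"
    by (auto simp: topspace_eq_carrier)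
  ultimately show ?thesis by blast
qed

end
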